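(* Let $G=(R,C,K)$ be an EM-grid with $1\le K\le C$, and let $\overline{R}=\lceil R/2\rceil$. Consider the full-grid cost $\mathcal{C}(G,u)=2\sum_{v\in G} d(v,u)$ for $u\in G$. Then the minimum of $\mathcal{C}(G,\cdot)$ over $G$ is attained at a vertex in row $\overline{R}$; i.e., a median $u^*=(r^*,c^* )\in\arg\min_{u\in G}\mathcal{C}(G,u)$ can be taken with $r^*=\overline{R}$.
   Context: The EM-grid $G=(R,C,K)$ has vertex set $\{1,\dots,R\}\times\{1,\dots,C\}$ (pairs (row, column)); its Euclidean part is $E=\{1,\dots,R\}\times\{1,\dots,K\}$, its border is $B=\{1,\dots,R\}\times\{K\}\subseteq E$, and its Manhattan part is $M=\{1,\dots,R\}\times\{K+1,\dots,C\}$. With $d_E(u,v)=\sqrt{(r_u-r_v)^2+(c_u-c_v)^2}$ and $d_M(u,v)=|r_u-r_v|+|c_u-c_v|$, the distance $d$ is: $d(u,v)=d_E(u,v)$ if $u,v\in E$; $d(u,v)=d_M(u,v)$ if $u,v\in M\cup B$; $d(u,v)=d_E(u,h)+d_M(h,v)$ with $h=(r_v,K)$ if $u\in E,v\in M$; and $d(u,v)=d_M(u,h)+d_E(h,v)$ with $h=(r_u,K)$ if $u\in M, v\in E$. *)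

theory Defs
  imports Complex_Main
begin

text \<open>A vertex is a pair (row, column), with 1-based indices.\<close>

type_synonym vertex = "nat \<times> nat"

definition em_vertices :: "nat \<Rightarrow> nat \<Rightarrow> nat \<Rightarrow> vertex set" where
  "em_vertices R C K = {1..R} \<times> {1..C}"

definition euclid_part :: "nat \<Rightarrow> nat \<Rightarrow> nat \<Rightarrow> vertex set" where
  "euclid_part R C K = {1..R} \<times> {1..K}"

definition border :: "nat \<Rightarrow> nat \<Rightarrow> nat \<Rightarrow> vertex set" where
  "border R C K = {1..R} \<times> {K}"

definition manhattan_part :: "nat \<Rightarrow> nat \<Rightarrow> nat \<Rightarrow> vertex set" where
  "manhattan_part R C K = {1..R} \<times> {K + 1..C}"

definition dist_E :: "vertex \<Rightarrow> vertex \<Rightarrow> real" where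
  "dist_E u v = sqrt ((real (fst u) - real (fst v))\<^sup>2 + (real (snd u) - real (snd v))\<^sup>2)"

definition dist_M :: "vertex \<Rightarrow> vertex \<Rightarrow> real" where
  "dist_M u v = \<bar>real (fst u) - real (fst v)\<bar> + \<bar>real (snd u) - real (snd v)\<bar>"

text \<open>
  The cases overlap on the border, where they agree, so their order is immaterial:
  see the four lemmas \<open>em_dist_EE\<close>, \<open>em_dist_MM\<close>, \<open>em_dist_EM\<close> and \<open>em_dist_ME\<close> below.
  For vertices of the grid, the last case is \<open>u\<close> in the Manhattan part and \<open>v\<close> in the
  Euclidean part; outside the grid the value is irrelevant.
\<close>

definition em_dist :: "nat \<Rightarrow> nat \<Rightarrow> nat \<Rightarrow> vertex \<Rightarrow> vertex \<Rightarrow> real" where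
  "em_dist R C K u v =
    (if u \<in> euclid_part R C K \<and> v \<in> euclid_part R C K then dist_E u v
     else if u \<in> manhattan_part R C K \<union> border R C K \<and> v \<in> manhattan_part R C K \<union> border R C K
       then dist_M u v
     else if u \<in> euclid_part R C K \<and> v \<in> manhattan_part R C K
       then dist_E u (fst v, K) + dist_M (fst v, K) v
     else dist_M u (fst u, K) + dist_E (fst u, K) v)"

definition em_cost :: "nat \<Rightarrow> nat \<Rightarrow> nat \<Rightarrow> vertex \<Rightarrow> real" where
  "em_cost R C K u = 2 * (\<Sum>v\<in>em_vertices R C K. em_dist R C K v u)"

lemma em_dist_EE:
  assumes "u \<in> euclid_part R C K" "v \<in> euclid_part R C K"
  shows "em_dist R C K u v = dist_E u v"
  using assms by (simp add: em_dist_def)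

lemma em_dist_MM:
  assumes "u \<in> manhattan_part R C K \<union> border R C K" "v \<in> manhattan_part R C K \<union> border R C K"
  shows "em_dist R C K u v = dist_M u v"
  using assms
  by (auto simp: em_dist_def dist_E_def dist_M_def euclid_part_def manhattan_part_def border_def)

lemma em_dist_EM:
  assumes "u \<in> euclid_part R C K" "v \<in> manhattan_part R C K"
  shows "em_dist R C K u v = dist_E u (fst v, K) + dist_M (fst v, K) v"
  using assms
  by (auto simp: em_dist_def dist_E_def dist_M_def euclid_part_def manhattan_part_def border_def)

lemma em_dist_ME:
  assumes "u \<in> manhattan_part R C K" "v \<in> euclid_part R C K"
  shows "em_dist R C K u v = dist_M u (fst u, K) + dist_E (fst u, K) v"
  using assms
  by (auto simp: em_dist_def dist_E_def dist_M_def euclid_part_def manhattan_part_def border_def)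

end

theory Submission imports Defs begin

text \<open>
  For fixed columns the distance of two vertices is a nondecreasing function g of their row
  difference. In a column, the total distance to a vertex in row r is therefore
  G r + G (R + 1 - r) - g 0, where G n is the sum of g over the numbers below n. Since G is
  convex, this is least when r and R + 1 - r are as close as possible, so moving any vertex to
  the middle row within its column does not increase the cost.
\<close>

text \<open>Discrete convexity of prefix sums: growing a prefix by \<open>k\<close> terms adds a
  block starting at \<open>a\<close> or at \<open>b\<close>, and the later block dominates the
  earlier one term by term.\<close>

lemma sum_lessThan_mono_shift:
  fixes g :: "nat \<Rightarrow> real"
  assumes "mono g" and "a \<le> b"
  shows "sum g {..<a + k} + sum g {..<b} \<le> sum g {..<a} + sum g {..<b + k}"
proof (induction k)
  case (Suc k)
  have "g (a + k) \<le> g (b + k)"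
    using assms by (simp add: monoD)
  with Suc show ?case by simp
qed simp

lemma sum_row_distances:
  fixes g :: "nat \<Rightarrow> real"
  assumes "1 \<le> r" and "r \<le> R"
  shows "(\<Sum>i=1..R. g (nat \<bar>int i - int r\<bar>)) = sum g {..<r} + sum g {..<R + 1 - r} - g 0"
proof -
  have "(\<Sum>i=1..R. g (nat \<bar>int i - int r\<bar>))
      = (\<Sum>i=1..r. g (nat \<bar>int i - int r\<bar>)) + (\<Sum>i=r+1..R. g (nat \<bar>int i - int r\<bar>))"
    using assms by (subst sum.union_disjoint[symmetric]) (auto intro!: sum.cong)
  also have "(\<Sum>i=1..r. g (nat \<bar>int i - int r\<bar>)) = sum g {..<r}"
    by (rule sum.reindex_bij_witness[of _ "\<lambda>j. r - j" "\<lambda>i. r - i"])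
      (auto simp: nat_diff_distrib' of_nat_diff abs_if intro!: arg_cong[of _ _ g])
  also have "(\<Sum>i=r+1..R. g (nat \<bar>int i - int r\<bar>)) = sum g {1..<R + 1 - r}"
    by (rule sum.reindex_bij_witness[of _ "\<lambda>j. r + j" "\<lambda>i. i - r"])
      (auto simp: nat_diff_distrib' of_nat_diff abs_if intro!: arg_cong[of _ _ g])
  \<comment> \<open>Row \<open>r\<close> itself is counted in the first block only, so completing
    the second block to a prefix sum costs one \<open>g 0\<close>.\<close>
  also have "sum g {1..<R + 1 - r} = sum g {..<R + 1 - r} - g 0"
    using assms by (simp add: lessThan_atLeast0 sum.atLeast_Suc_lessThan)
  finally show ?thesis by simp
qed

lemma sum_row_distances_middle_le:
  fixes g :: "nat \<Rightarrow> real"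
  assumes "mono g" and "1 \<le> r" and "r \<le> R"
  shows "(\<Sum>i=1..R. g (nat \<bar>int i - int ((R + 1) div 2)\<bar>)) \<le> (\<Sum>i=1..R. g (nat \<bar>int i - int r\<bar>))"
proof -
  \<comment> \<open>This choice gives m \<le> R + 1 - m \<le> m + 1: the two prefix lengths are as
    balanced as parity allows.\<close>
  define m where "m = (R + 1) div 2"
  have m: "1 \<le> m" "m \<le> R"
    using assms by (auto simp: m_def)
  have "sum g {..<m} + sum g {..<R + 1 - m} \<le> sum g {..<r} + sum g {..<R + 1 - r}"
  proof (cases "r \<le> m")
    case True
    then have "r \<le> R + 1 - m" "r + (m - r) = m" "R + 1 - m + (m - r) = R + 1 - r"
      using m by (auto simp: m_def)
    then show ?thesis
      using sum_lessThan_mono_shift[OF assms(1), of r "R + 1 - m" "m - r"] by simp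
  next
    case False
    \<comment> \<open>Here \<open>r\<close> exceeds \<open>m\<close> by at least 1, which absorbs
      the possible excess of R + 1 - m over \<open>m\<close>. The prefixes swap roles: the one of
      length R + 1 - r is now the shorter.\<close>
    then have "R + 1 - r \<le> m" "R + 1 - r + (r - m) = R + 1 - m" "m + (r - m) = r"
      using assms by (auto simp: m_def)
    then show ?thesis
      using sum_lessThan_mono_shift[OF assms(1), of "R + 1 - r" m "r - m"] by simp
  qed
  then show ?thesis
    unfolding m_def[symmetric] by (simp only: sum_row_distances assms m diff_right_mono)
qed

text \<open>In the mixed case \<open>min\<close> picks the Euclidean column and \<open>max\<close>
  the Manhattan one, so one formula serves both directions. The path meets the border in the row of
  the Manhattan vertex, so the row difference \<open>n\<close> enters the Euclidean leg
  only.\<close>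

definition row_profile :: "nat \<Rightarrow> nat \<Rightarrow> nat \<Rightarrow> nat \<Rightarrow> real" where
  "row_profile K c c' n =
    (if c \<le> K \<and> c' \<le> K then sqrt ((real n)\<^sup>2 + (real c - real c')\<^sup>2)
     else if K \<le> c \<and> K \<le> c' then real n + \<bar>real c - real c'\<bar>
     else sqrt ((real n)\<^sup>2 + (real (min c c') - real K)\<^sup>2) + (real (max c c') - real K))"

lemma mono_row_profile: "mono (row_profile K c c')"
  by (rule monoI) (auto simp: row_profile_def intro!: real_sqrt_le_mono power_mono)

lemma em_dist_eq_row_profile:
  assumes "(i, c) \<in> em_vertices R C K" and "(r, c') \<in> em_vertices R C K"
  shows "em_dist R C K (i, c) (r, c') = row_profile K c c' (nat \<bar>int i - int r\<bar>)"
proof -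
  have n: "real (nat \<bar>int i - int r\<bar>) = \<bar>real i - real r\<bar>" by simp
  have sym: "(real K - x)\<^sup>2 = (x - real K)\<^sup>2" for x
    by (rule power2_commute)
  show ?thesis
    unfolding row_profile_def n using assms
    by (auto simp: em_dist_def dist_E_def dist_M_def em_vertices_def euclid_part_def
        manhattan_part_def border_def min_def max_def sym)
qed

lemma em_cost_middle_row_le:
  assumes "(r, c) \<in> em_vertices R C K"
  shows "em_cost R C K ((R + 1) div 2, c) \<le> em_cost R C K (r, c)"
proof -
  have cost: "em_cost R C K (r, c)
      = 2 * (\<Sum>c'=1..C. \<Sum>i=1..R. row_profile K c' c (nat \<bar>int i - int r\<bar>))"
    if "(r, c) \<in> em_vertices R C K" for r
  proof -
    have "(\<Sum>v\<in>em_vertices R C K. em_dist R C K v (r, c))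
        = (\<Sum>i=1..R. \<Sum>c'=1..C. em_dist R C K (i, c') (r, c))"
      by (simp add: em_vertices_def sum.cartesian_product)
    also have "\<dots> = (\<Sum>i=1..R. \<Sum>c'=1..C. row_profile K c' c (nat \<bar>int i - int r\<bar>))"
      using that by (intro sum.cong refl em_dist_eq_row_profile) (auto simp: em_vertices_def)
    \<comment> \<open>With columns outermost, each inner sum involves a single monotone
      profile.\<close>
    also have "\<dots> = (\<Sum>c'=1..C. \<Sum>i=1..R. row_profile K c' c (nat \<bar>int i - int r\<bar>))"
      by (rule sum.swap)
    finally show ?thesis by (simp add: em_cost_def)
  qed
  have "((R + 1) div 2, c) \<in> em_vertices R C K"
    using assms by (auto simp: em_vertices_def)
  moreover have "(\<Sum>c'=1..C. \<Sum>i=1..R. row_profile K c' c (nat \<bar>int i - int ((R + 1) div 2)\<bar>))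
      \<le> (\<Sum>c'=1..C. \<Sum>i=1..R. row_profile K c' c (nat \<bar>int i - int r\<bar>))"
    using assms
    by (intro sum_mono sum_row_distances_middle_le mono_row_profile) (auto simp: em_vertices_def)
  ultimately show ?thesis
    using cost assms by simp
qed

theorem theorem1:
  fixes R C K :: nat
  assumes "1 \<le> R" and "1 \<le> K" and "K \<le> C"
  shows "\<exists>u. is_arg_min (em_cost R C K) (\<lambda>w. w \<in> em_vertices R C K) u \<and>
             int (fst u) = \<lceil>real R / 2\<rceil>"
proof -
  have "finite (em_vertices R C K)" and "em_vertices R C K \<noteq> {}"
    using assms by (auto simp: em_vertices_def)
  then obtain w where "is_arg_min (em_cost R C K) (\<lambda>w. w \<in> em_vertices R C K) w"
    using ex_is_arg_min_if_finite by blast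
  then have w: "w \<in> em_vertices R C K"
    and le: "\<And>v. v \<in> em_vertices R C K \<Longrightarrow> em_cost R C K w \<le> em_cost R C K v"
    by (auto simp: is_arg_min_linorder)
  \<comment> \<open>Any minimizer \<open>w\<close> is slid within its own column to the middle
    row.\<close>
  define u where "u = ((R + 1) div 2, snd w)"
  have "u \<in> em_vertices R C K"
    using w by (auto simp: u_def em_vertices_def)
  moreover have "em_cost R C K u \<le> em_cost R C K w"
    using em_cost_middle_row_le[of "fst w" "snd w"] w by (simp add: u_def)
  ultimately have "is_arg_min (em_cost R C K) (\<lambda>w. w \<in> em_vertices R C K) u"
    using le by (force simp: is_arg_min_linorder)
  moreover have "int (fst u) = \<lceil>real R / 2\<rceil>"
    unfolding u_def by (cases "even R") (auto elim!: evenE oddE intro!: ceiling_unique[symmetric])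
  ultimately show ?thesis by blast
qed

end
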